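(* There exist infinite P-rankable sets $A, B\subseteq\Sigma^*$ such that $A\cup B$ is not $\mathrm{F}_{\mathrm{PR}}$-compressible.
   Context: $\Sigma=\{0,1\}$; strings are ordered in length-lexicographic order, and natural numbers are identified with strings in the standard way. For $A\subseteq\Sigma^*$, $\mathrm{rank}_A(y)=\|\{z\mid z\le y \wedge z\in A\}\|$. A (possibly partial) function $f$ is a ranking function for $A$ if $\mathrm{domain}(f)\supseteq A$ and $f(x)=\mathrm{rank}_A(x)$ for all $x\in A$ (no requirement for $x\notin A$). $A$ is P-rankable if it has a ranking function that is a total polynomial-time computable function. A (possibly partial) function $f$ is a compression function for $A$ if $\mathrm{domain}(f)\supseteq A$, $f(A)=\Sigma^*$, and $f$ is injective on $A$. $\mathrm{F}_{\mathrm{PR}}$ is the class of partial recursive functions from $\Sigma^*$ to $\Sigma^*$, and $A$ is $\mathrm{F}_{\mathrm{PR}}$-compressible if some $f\in\mathrm{F}_{\mathrm{PR}}$ is a compression function for $A$. *)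

theory Defs
  imports
    "HOL-Library.List_Lenlexorder"
    "HOL-Computational_Algebra.Polynomial"
begin

text \<open>
  Strings over \<open>{0,1}\<close> are lists of Booleans, with \<open>False\<close> for 0 and \<open>True\<close> for 1. The imported
  instance makes \<open>\<le>\<close> on lists the length-lexicographic order.
\<close>

type_synonym str = "bool list"


subsection \<open>Strings as natural numbers\<close>

text \<open>
  A string stands for its position in the length-lexicographic order, so the empty string is the
  number 0, and \<open>0, 1, 00, 01, \<dots>\<close> are \<open>1, 2, 3, 4, \<dots>\<close>.
\<close>

definition nat_of_str :: "str \<Rightarrow> nat" where
  "nat_of_str w = card {z. z < w}"

lemma finite_str_le: "finite {z :: str. z \<le> w}"
proof (rule finite_subset)
  show "{z. z \<le> w} \<subseteq> {z. set z \<subseteq> UNIV \<and> length z \<le> length w}"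
    by (auto simp: list_le_def list_less_def lenlex_conv)
  show "finite {z :: str. set z \<subseteq> UNIV \<and> length z \<le> length w}"
    by (rule finite_lists_length_le) simp
qed

lemma finite_str_less: "finite {z :: str. z < w}"
  by (rule finite_subset[OF _ finite_str_le[of w]]) auto

lemma nat_of_str_strict_mono: "strict_mono nat_of_str"
  unfolding strict_mono_def nat_of_str_def
  by (intro allI impI psubset_card_mono finite_str_less) (auto intro: less_trans)

lemma bij_nat_of_str: "bij nat_of_str"
  unfolding bij_def
proof
  show inj: "inj nat_of_str"
    by (rule strict_mono_imp_inj_on[OF nat_of_str_strict_mono])
  have down: "n \<in> range nat_of_str" if "n \<le> nat_of_str w" for n w
    using that
  proof (induction "nat_of_str w" arbitrary: w)
    case 0
    then show ?case by (metis le_zero_eq rangeI)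
  next
    case (Suc m)
    show ?case
    proof (cases "n = Suc m")
      case True
      then show ?thesis using Suc.hyps(2) by (metis rangeI)
    next
      case False
      let ?S = "{z. z < w}"
      have "?S \<noteq> {}"
        using Suc.hyps(2) unfolding nat_of_str_def by (metis card.empty nat.distinct(1))
      then have mem: "Max ?S < w"
        using Max_in[OF finite_str_less[of w]] by blast
      have "?S = insert (Max ?S) {z. z < Max ?S}"
        using mem Max_ge[OF finite_str_less[of w]] by (auto simp: le_less)
      then have "card ?S = Suc (card {z. z < Max ?S})"
        by (metis card_insert_disjoint finite_str_less less_irrefl mem_Collect_eq)
      then have "m = nat_of_str (Max ?S)"
        using Suc.hyps(2) by (simp add: nat_of_str_def)
      then show ?thesis
        using Suc.hyps(1) Suc.prems Suc.hyps(2) False by (metis le_SucE)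
    qed
  qed
  have "infinite (range nat_of_str)"
    using inj infinite_UNIV_listI finite_imageD by blast
  then show "range nat_of_str = UNIV"
    using down by (metis UNIV_eq_I finite_nat_set_iff_bounded_le linear rangeE)
qed


subsection \<open>Turing machines\<close>

text \<open>
  Deterministic machines with a single two-way infinite tape. A machine is its transition table,
  taking a state and a scanned symbol to a new state, a symbol to write and a head move; it halts
  when the table has no entry. Only tables with finite domain are machines, which makes the sets of
  states and tape symbols in use finite. State 0 is the start state, and \<open>Aux n\<close> are the auxiliary
  tape symbols.
\<close>

datatype sym = Blank | Bit bool | Aux nat

datatype move = Lft | Stay | Rgt

type_synonym tm = "nat \<times> sym \<rightharpoonup> nat \<times> sym \<times> move"

type_synonym config = "nat \<times> (int \<Rightarrow> sym) \<times> int"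

fun offset :: "move \<Rightarrow> int" where
  "offset Lft = -1"
| "offset Stay = 0"
| "offset Rgt = 1"

fun halted :: "tm \<Rightarrow> config \<Rightarrow> bool" where
  "halted M (q, T, h) \<longleftrightarrow> M (q, T h) = None"

fun step :: "tm \<Rightarrow> config \<Rightarrow> config" where
  "step M (q, T, h) =
    (case M (q, T h) of
       None \<Rightarrow> (q, T, h)
     | Some (q', s, m) \<Rightarrow> (q', T(h := s), h + offset m))"

definition tape_of :: "str \<Rightarrow> int \<Rightarrow> sym" where
  "tape_of x i = (if 0 \<le> i \<and> nat i < length x then Bit (x ! nat i) else Blank)"

definition config_at :: "tm \<Rightarrow> str \<Rightarrow> nat \<Rightarrow> config" where
  "config_at M x t = (step M ^^ t) (0, tape_of x, 0)"

text \<open>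
  Halting is absorbing, so \<open>halts_with M x t y\<close> says that \<open>M\<close> on input \<open>x\<close> halts after at most \<open>t\<close>
  steps with exactly \<open>y\<close> on the tape; the final head position is immaterial.
\<close>

definition halts_with :: "tm \<Rightarrow> str \<Rightarrow> nat \<Rightarrow> str \<Rightarrow> bool" where
  "halts_with M x t y \<longleftrightarrow>
    halted M (config_at M x t) \<and> fst (snd (config_at M x t)) = tape_of y"

definition computes :: "tm \<Rightarrow> (str \<rightharpoonup> str) \<Rightarrow> bool" where
  "computes M f \<longleftrightarrow>
    (\<forall>x. case f x of
           None \<Rightarrow> (\<forall>t. \<not> halted M (config_at M x t))
         | Some y \<Rightarrow> (\<exists>t. halts_with M x t y))"

definition F_PR :: "(str \<rightharpoonup> str) set" where
  "F_PR = {f. \<exists>M. finite (dom M) \<and> computes M f}"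

definition polytime :: "(str \<Rightarrow> str) \<Rightarrow> bool" where
  "polytime f \<longleftrightarrow>
    (\<exists>M (p :: nat poly). finite (dom M) \<and>
       (\<forall>x. halts_with M x (poly p (length x)) (f x)))"


subsection \<open>Ranking and compression\<close>

definition rank :: "str set \<Rightarrow> str \<Rightarrow> nat" where
  "rank A y = card {z. z \<le> y \<and> z \<in> A}"

definition ranking_function :: "(str \<rightharpoonup> str) \<Rightarrow> str set \<Rightarrow> bool" where
  "ranking_function f A \<longleftrightarrow>
    A \<subseteq> dom f \<and> (\<forall>x\<in>A. nat_of_str (the (f x)) = rank A x)"

definition P_rankable :: "str set \<Rightarrow> bool" where
  "P_rankable A \<longleftrightarrow> (\<exists>f. polytime f \<and> ranking_function (\<lambda>x. Some (f x)) A)"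

definition compression_function :: "(str \<rightharpoonup> str) \<Rightarrow> str set \<Rightarrow> bool" where
  "compression_function f A \<longleftrightarrow>
    A \<subseteq> dom f \<and> (\<lambda>x. the (f x)) ` A = UNIV \<and> inj_on (\<lambda>x. the (f x)) A"

definition compressible :: "(str \<rightharpoonup> str) set \<Rightarrow> str set \<Rightarrow> bool" where
  "compressible F A \<longleftrightarrow> (\<exists>f\<in>F. compression_function f A)"

end

theory Submission
  imports Defs "HOL-Library.Countable_Set"
begin

text \<open>
  Let \<open>A\<close> contain exactly one of \<open>w0\<close>, \<open>w1\<close> for every nonempty \<open>w\<close>. Whatever the choices, the rank
  in \<open>A\<close> of the chosen extension of \<open>w\<close> is the number of \<open>w\<close>, so deleting the last bit ranks \<open>A\<close>.
  The union of two such sets can be any set \<open>C\<close> of strings of length at least 2 that meets every pair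
  \<open>{w0, w1}\<close>. As there are only countably many partial recursive functions, some such \<open>C\<close> defeats
  them all: a function \<open>f\<close> that is undefined or not injective somewhere on the undecided strings is
  defeated by putting the witnesses into \<open>C\<close>; otherwise some undecided \<open>w0\<close> has an \<open>f\<close>-value not
  attained on the finitely many decided strings, and leaving \<open>w0\<close> out of \<open>C\<close> destroys surjectivity.
\<close>

subsection \<open>Countability of the partial recursive functions\<close>

instance sym :: countable by countable_datatype

instance move :: countable by countable_datatype

lemma tape_of_inject: "tape_of x = tape_of y \<longleftrightarrow> x = y"
proof
  assume eq: "tape_of x = tape_of y"
  have "length v \<le> length u" if "tape_of u = tape_of v" for u v
  proof (rule ccontr)
    assume "\<not> length v \<le> length u"
    with fun_cong[OF that, of "int (length u)"] show False
      by (simp add: tape_of_def)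
  qed
  from this[OF eq] this[OF eq[symmetric]] have len: "length x = length y"
    by simp
  have "x ! i = y ! i" if "i < length x" for i
    using fun_cong[OF eq, of "int i"] that len by (simp add: tape_of_def)
  with len show "x = y"
    by (simp add: nth_equalityI)
qed simp

lemma step_halted: "halted M c \<Longrightarrow> step M c = c"
  by (cases c) simp

lemma config_at_halted:
  assumes "halted M (config_at M x t)" "t \<le> t'"
  shows "config_at M x t' = config_at M x t"
  using assms(2)
proof (induction t' rule: dec_induct)
  case (step n)
  with assms(1) show ?case
    by (simp add: config_at_def step_halted)
qed simp

lemma halts_with_unique:
  assumes "halts_with M x t y" "halts_with M x t' y'"
  shows "y = y'"
proof -
  have "config_at M x t = config_at M x t'"
    using assms config_at_halted[of M x t t'] config_at_halted[of M x t' t] linear[of t t']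
    unfolding halts_with_def by auto
  with assms show ?thesis
    by (simp add: halts_with_def tape_of_inject)
qed

lemma option_eqI:
  assumes "\<And>b. f = Some b \<longleftrightarrow> g = Some b"
  shows "f = g"
proof (cases f)
  case None
  then show ?thesis
    using assms[of "the g"] by (cases g) simp_all
next
  case (Some b)
  then show ?thesis
    using assms[of b] by simp
qed

text \<open>Having value \<open>y\<close> at \<open>x\<close> amounts to a halting run on
  \<open>x\<close> with output \<open>y\<close>, a condition on the machine alone.\<close>

lemma computes_unique:
  assumes f: "computes M f" and g: "computes M g"
  shows "f = g"
proof
  fix x
  have iff: "h x = Some y \<longleftrightarrow> (\<exists>t. halts_with M x t y)" if h: "computes M h" for h y
  proof (cases "h x")
    case None
    then show ?thesis
      using spec[OF h[unfolded computes_def], of x] by (simp add: halts_with_def)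
  next
    case (Some z)
    then obtain t where t: "halts_with M x t z"
      using spec[OF h[unfolded computes_def], of x] by auto
    then have "(\<exists>t. halts_with M x t y) \<longleftrightarrow> z = y"
      by (blast dest: halts_with_unique)
    with Some show ?thesis
      by simp
  qed
  have "f x = Some y \<longleftrightarrow> g x = Some y" for y
    using iff[OF f] iff[OF g] by blast
  then show "f x = g x"
    by (rule option_eqI)
qed

text \<open>A finite partial map is determined by its graph, a finite subset of a countable
  type.\<close>

lemma countable_finite_dom:
  "countable {M :: 'a :: countable \<rightharpoonup> 'b :: countable. finite (dom M)}"
proof (rule countable_image_inj_on)
  have "finite (Map.graph M)" if "finite (dom M)" for M :: "'a \<rightharpoonup> 'b"
    using that by (simp add: finite_graph_iff_finite_dom)
  then have "Map.graph ` {M :: 'a \<rightharpoonup> 'b. finite (dom M)} \<subseteq> Collect finite"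
    by blast
  moreover have "countable (Collect finite :: ('a \<times> 'b) set set)"
    by (rule countable_Collect_finite)
  ultimately show "countable (Map.graph ` {M :: 'a \<rightharpoonup> 'b. finite (dom M)})"
    by (rule countable_subset)
  show "inj_on Map.graph {M :: 'a \<rightharpoonup> 'b. finite (dom M)}"
  proof (rule inj_onI, rule ext)
    fix M N :: "'a \<rightharpoonup> 'b" and a
    assume eq: "Map.graph M = Map.graph N"
    have "M a = Some b \<longleftrightarrow> N a = Some b" for b
      using in_graphI[of M a b] in_graphI[of N a b] in_graphD[of a b M] in_graphD[of a b N]
      unfolding eq by blast
    then show "M a = N a"
      by (rule option_eqI)
  qed
qed

lemma countable_F_PR: "countable F_PR"
proof (rule countable_subset)
  \<comment> \<open>A machine that computes no function is sent to an unspecified value; an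
    inclusion suffices for countability.\<close>
  show "F_PR \<subseteq> (\<lambda>M. THE f. computes M f) ` {M. finite (dom M)}"
  proof
    fix f assume "f \<in> F_PR"
    then obtain M where M: "finite (dom M)" "computes M f"
      by (auto simp: F_PR_def)
    then have "(THE f. computes M f) = f"
      by (blast intro: computes_unique)
    with M show "f \<in> (\<lambda>M. THE f. computes M f) ` {M. finite (dom M)}"
      by force
  qed
qed (intro countable_image countable_finite_dom)


subsection \<open>Deleting the last bit ranks a set with one extension of every nonempty string\<close>

text \<open>State 0 seeks the right end, state 1 erases the last bit, and state 2 halts. On empty
  input state 1 sees a blank and halts at once, matching \<open>butlast [] = []\<close>.\<close>

definition eraser :: tm where
  "eraser =
    [(0, Bit False) \<mapsto> (0, Bit False, Rgt), (0, Bit True) \<mapsto> (0, Bit True, Rgt),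
     (0, Blank) \<mapsto> (1, Blank, Lft),
     (1, Bit False) \<mapsto> (2, Blank, Stay), (1, Bit True) \<mapsto> (2, Blank, Stay)]"

lemma eraser_simps:
  "eraser (0, Bit b) = Some (0, Bit b, Rgt)"
  "eraser (0, Blank) = Some (1, Blank, Lft)"
  "eraser (Suc 0, Bit b) = Some (2, Blank, Stay)"
  "eraser (Suc 0, Blank) = None"
  "eraser (2, s) = None"
  by (cases b; simp add: eraser_def)+

lemma config_at_eraser:
  "i \<le> length x \<Longrightarrow> config_at eraser x i = (0, tape_of x, int i)"
proof (induction i)
  case (Suc i)
  then have "tape_of x (int i) = Bit (x ! i)"
    by (simp add: tape_of_def)
  moreover from this have "(tape_of x)(int i := Bit (x ! i)) = tape_of x"
    by (metis fun_upd_triv)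
  ultimately show ?case
    using Suc by (simp add: config_at_def eraser_simps)
qed (simp add: config_at_def)

text \<open>The scan takes \<open>length x\<close> steps, turning back one, erasing one. Empty input
  halts a step early, which is harmless as halting is absorbing.\<close>

lemma halts_with_eraser: "halts_with eraser x (length x + 2) (butlast x)"
proof -
  have blank: "tape_of x (int (length x)) = Blank"
    by (simp add: tape_of_def)
  then have "(tape_of x)(int (length x) := Blank) = tape_of x"
    by (metis fun_upd_triv)
  with blank have one: "config_at eraser x (Suc (length x)) = (1, tape_of x, int (length x) - 1)"
    using config_at_eraser[of "length x" x] by (simp add: config_at_def eraser_simps)
  have two: "config_at eraser x (length x + 2) = step eraser (1, tape_of x, int (length x) - 1)"
    using one by (simp add: config_at_def)
  show ?thesis
  proof (cases x rule: rev_cases)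
    case Nil
    then show ?thesis
      using two by (simp add: halts_with_def tape_of_def eraser_simps)
  next
    case (snoc w b)
    have "tape_of x (int (length x) - 1) = Bit b"
      by (simp add: tape_of_def snoc)
    moreover have "(tape_of x)(int (length x) - 1 := Blank) = tape_of w"
      by (rule ext) (auto simp: tape_of_def snoc nth_append)
    ultimately show ?thesis
      using two snoc by (simp add: halts_with_def eraser_simps)
  qed
qed

lemma polytime_butlast: "polytime butlast"
  unfolding polytime_def
proof (intro exI conjI allI)
  show "finite (dom eraser)"
    by (simp add: eraser_def)
  show "halts_with eraser x (poly [:2, 1:] (length x)) (butlast x)" for x
    using halts_with_eraser[of x] by (simp add: add.commute)
qed

definition extensions :: "(str \<Rightarrow> bool) \<Rightarrow> str set" where
  "extensions c = (\<lambda>w. w @ [c w]) ` {w. w \<noteq> []}"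

lemma infinite_extensions: "infinite (extensions c)"
proof -
  have "infinite {w :: str. w \<noteq> []}"
    using infinite_UNIV_listI[where 'a = bool] by (simp add: Collect_neg_eq finite_compl)
  moreover have "inj_on (\<lambda>w. w @ [c w]) {w. w \<noteq> []}"
    by (auto simp: inj_on_def)
  ultimately show ?thesis
    unfolding extensions_def by (simp add: finite_image_iff)
qed

text \<open>A difference in length persists; at equal length the first difference lies in the
  prefixes.\<close>

lemma append_less_append:
  fixes v w :: str
  assumes "v < w" "length s = length t"
  shows "v @ s < w @ t"
  using assms lenlex_append1 unfolding list_less_def by blast

lemma append_choice_le_iff:
  fixes v w :: str
  shows "v @ [c v] \<le> w @ [c w] \<longleftrightarrow> v \<le> w"
proof (cases v w rule: linorder_cases)
  case less
  then show ?thesis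
    using append_less_append[of v w "[c v]" "[c w]"] by (simp add: less_imp_le)
next
  case greater
  then show ?thesis
    using append_less_append[of w v "[c w]" "[c v]"] by (simp add: not_le [symmetric])
qed simp

text \<open>Appending the chosen bits preserves order, so the members counted correspond to the
  nonempty \<open>v \<le> w\<close>. Losing the empty string offsets counting \<open>w\<close>
  itself, which \<open>nat_of_str\<close> leaves out.\<close>

lemma rank_extensions:
  assumes "w \<noteq> []"
  shows "rank (extensions c) (w @ [c w]) = nat_of_str w"
proof -
  have "{z. z \<le> w @ [c w] \<and> z \<in> extensions c} = (\<lambda>v. v @ [c v]) ` ({v. v \<le> w} - {[]})"
    by (auto simp: extensions_def append_choice_le_iff)
  moreover have "inj_on (\<lambda>v. v @ [c v]) ({v. v \<le> w} - {[]})"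
    by (auto simp: inj_on_def)
  ultimately have "rank (extensions c) (w @ [c w]) = card ({v. v \<le> w} - {[]})"
    by (simp add: rank_def card_image)
  also have "\<dots> = card {v. v \<le> w} - 1"
    by (simp add: card_Diff_singleton)
  also have "{v. v \<le> w} = insert w {v. v < w}"
    by auto
  finally show ?thesis
    by (simp add: finite_str_less nat_of_str_def)
qed

lemma P_rankable_extensions: "P_rankable (extensions c)"
  unfolding P_rankable_def ranking_function_def
  using polytime_butlast rank_extensions
  by (intro exI[of _ butlast]) (auto simp: extensions_def)


subsection \<open>Diagonalization\<close>

text \<open>Describes unions of two \<open>extensions\<close> sets without choice functions, so that
  the diagonalization can build a single set.\<close>

definition covering :: "str set \<Rightarrow> bool" where
  "covering C \<longleftrightarrow> (\<forall>x\<in>C. 2 \<le> length x) \<and> (\<forall>w. w \<noteq> [] \<longrightarrow> (\<exists>b. w @ [b] \<in> C))"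

lemma covering_eq_Un_extensions:
  assumes "covering C"
  obtains a b where "C = extensions a \<union> extensions b"
proof (rule that, rule set_eqI)
  fix x
  \<comment> \<open>One choice prefers \<open>True\<close>, the other \<open>False\<close>; each
    falls back on the opposite bit, which covering then puts in \<open>C\<close>.\<close>
  show "x \<in> C \<longleftrightarrow> x \<in> extensions (\<lambda>w. w @ [True] \<in> C) \<union> extensions (\<lambda>w. w @ [False] \<notin> C)"
  proof (cases x rule: rev_cases)
    case Nil
    then show ?thesis
      using assms by (auto simp: covering_def extensions_def)
  next
    case (snoc w b)
    show ?thesis
    proof (cases "w = []")
      case True
      then show ?thesis
        using assms snoc by (auto simp: covering_def extensions_def)
    next
      case False
      then have "w @ [True] \<in> C \<or> w @ [False] \<in> C"
        using assms unfolding covering_def by (metis (full_types))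
      then show ?thesis
        using False snoc by (cases b) (auto simp: extensions_def)
    qed
  qed
qed

definition agree_below :: "nat \<Rightarrow> str set \<Rightarrow> str set \<Rightarrow> bool" where
  "agree_below n C D \<longleftrightarrow> (\<forall>x. length x < n \<longrightarrow> (x \<in> C \<longleftrightarrow> x \<in> D))"

text \<open>One stage of the construction. Quantifying over all \<open>E\<close> that agree with
  \<open>D\<close> below \<open>m\<close> lets the defeat of \<open>f\<close> survive later stages.
  \<open>D\<close> adds to \<open>C\<close> all undecided strings, minus at most one.\<close>

lemma defeat_extend:
  assumes C: "covering C" and n: "2 \<le> n"
  obtains D m where "covering D" "n < m" "agree_below n C D"
    "\<And>E. agree_below m D E \<Longrightarrow> \<not> compression_function f E"
proof -
  let ?fresh = "{x :: str. n \<le> length x}"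
  have cov: "covering (C \<union> ?fresh)" and agr: "agree_below n C (C \<union> ?fresh)"
    using C n by (auto simp: covering_def agree_below_def)
  consider (undef) x where "x \<in> ?fresh" "f x = None"
    | (collision) x y where "x \<in> ?fresh" "y \<in> ?fresh" "x \<noteq> y" "the (f x) = the (f y)"
    | (inj) "inj_on (\<lambda>x. the (f x)) ?fresh"
    unfolding inj_on_def by blast
  then show thesis
  proof cases
    case undef
    show thesis
    proof (rule that[OF cov _ agr])
      show "n < Suc (length x)"
        using undef by simp
      fix E assume "agree_below (Suc (length x)) (C \<union> ?fresh) E"
      then have "x \<in> E"
        using undef by (auto simp: agree_below_def)
      then show "\<not> compression_function f E"
        using undef by (auto simp: compression_function_def)
    qed
  next
    case collision
    show thesis
    proof (rule that[OF cov _ agr])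
      show "n < Suc (length x + length y)"
        using collision by simp
      fix E assume "agree_below (Suc (length x + length y)) (C \<union> ?fresh) E"
      then have "z \<in> E" if "z \<in> ?fresh" "length z \<le> length x + length y" for z
        using that by (auto simp: agree_below_def less_Suc_eq_le)
      then have "x \<in> E" "y \<in> E"
        using collision(1,2) by simp_all
      then show "\<not> compression_function f E"
        using collision(3,4) unfolding compression_function_def inj_on_def by blast
    qed
  next
    case inj
    \<comment> \<open>Infinitely many undecided strings \<open>w @ [False]\<close> whose siblings
      \<open>w @ [True]\<close> are undecided too.\<close>
    let ?g = "\<lambda>x. the (f x)" and ?zeros = "(\<lambda>k. replicate (n + k) False @ [False]) ` UNIV"
    have "infinite ?zeros"
      by (rule range_inj_infinite) (auto simp: inj_on_def dest: arg_cong[of _ _ length])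
    moreover have "inj_on ?g ?zeros"
      by (rule inj_on_subset[OF inj]) auto
    ultimately have "infinite (?g ` ?zeros)"
      by (simp add: finite_image_iff)
    moreover have "finite {x :: str. length x < n}"
      by (rule finite_subset[OF _ finite_lists_length_le[of UNIV n]]) auto
    ultimately have "\<not> ?g ` ?zeros \<subseteq> ?g ` {x. length x < n}"
      using finite_subset by blast
    then obtain k where k: "?g (replicate (n + k) False @ [False]) \<notin> ?g ` {x. length x < n}"
      by blast
    define w where "w = replicate (n + k) False"
    define x where "x = w @ [False]"
    have x: "n < length x" "?g x \<notin> ?g ` {x. length x < n}"
      using k by (auto simp: x_def w_def)
    show thesis
    proof (rule that)
      show "covering (C \<union> ?fresh - {x})"
        unfolding covering_def
      proof (intro conjI ballI allI impI)
        fix v :: str assume "v \<noteq> []"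
        then obtain b where "v @ [b] \<in> C \<union> ?fresh"
          using cov unfolding covering_def by blast
        \<comment> \<open>The sibling keeps the pair of \<open>w\<close> covered once
          \<open>x\<close> is removed.\<close>
        moreover have "w @ [True] \<in> C \<union> ?fresh"
          by (simp add: w_def)
        ultimately show "\<exists>b. v @ [b] \<in> C \<union> ?fresh - {x}"
          by (cases "v = w") (auto simp: x_def)
      qed (use cov in \<open>auto simp: covering_def\<close>)
      show "n < Suc (length x)"
        using x by simp
      show "agree_below n C (C \<union> ?fresh - {x})"
        using agr x by (auto simp: agree_below_def)
      fix E assume "agree_below (Suc (length x)) (C \<union> ?fresh - {x}) E"
      then have "x \<notin> E"
        by (auto simp: agree_below_def)
      show "\<not> compression_function f E"
      proof
        assume "compression_function f E"
        \<comment> \<open>Surjectivity yields a preimage \<open>y\<close> in \<open>E\<close>. The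
          choice of \<open>x\<close> rules out a short \<open>y\<close>; injectivity on long strings
          forces \<open>y = x\<close>, even beyond the bound up to which \<open>E\<close> is
          controlled.\<close>
        then have "?g x \<in> ?g ` E"
          by (simp add: compression_function_def)
        then obtain y where y: "y \<in> E" "?g x = ?g y"
          by blast
        have "n \<le> length y"
        proof (rule ccontr)
          assume "\<not> n \<le> length y"
          then have "y \<in> {x. length x < n}"
            by simp
          with x(2) y(2) show False
            by (metis imageI)
        qed
        then have "x = y"
          using inj_onD[OF inj y(2)] x(1) by simp
        with y \<open>x \<notin> E\<close> show False
          by simp
      qed
    qed
  qed
qed

lemma ex_covering_incompressible:
  assumes "countable F"
  shows "\<exists>C. covering C \<and> \<not> compressible F C"
proof -
  \<comment> \<open>Inserting \<open>Map.empty\<close> makes the enumerated set nonempty, so that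
    \<open>e\<close> has it as its range.\<close>
  define e where "e = from_nat_into (insert Map.empty F)"
  have F: "F \<subseteq> range e"
    using assms range_from_nat_into[of "insert Map.empty F"] by (auto simp: e_def)
  \<comment> \<open>The bound \<open>k + 2\<close> makes every string decided eventually.\<close>
  define P where "P = (\<lambda>(k :: nat) (C, n). covering C \<and> k + 2 \<le> n)"
  define Q where "Q = (\<lambda>k (C, n) (D, m). n < m \<and> agree_below n C D \<and>
    (\<forall>E. agree_below m D E \<longrightarrow> \<not> compression_function (e k) E))"
  have "\<exists>s. \<forall>k. P k (s k) \<and> Q k (s k) (s (Suc k))"
  proof (rule dependent_nat_choice)
    show "\<exists>s. P 0 s"
      by (rule exI[of _ "({x. 2 \<le> length x}, 2)"]) (auto simp: P_def covering_def Suc_le_eq)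
    fix s k assume "P k s"
    then obtain C n where s: "s = (C, n)" "covering C" "k + 2 \<le> n"
      by (auto simp: P_def)
    obtain D m where "covering D" "n < m" "agree_below n C D"
      "\<And>E. agree_below m D E \<Longrightarrow> \<not> compression_function (e k) E"
      using defeat_extend[of C n "e k"] s by auto
    with s have "P (Suc k) (D, m) \<and> Q k s (D, m)"
      by (auto simp: P_def Q_def)
    then show "\<exists>s'. P (Suc k) s' \<and> Q k s s'" ..
  qed
  then obtain s where s: "\<And>k. P k (s k)" "\<And>k. Q k (s k) (s (Suc k))"
    by blast
  define C where "C k = fst (s k)" for k
  define n where "n k = snd (s k)" for k
  have pair: "s k = (C k, n k)" for k
    by (simp add: C_def n_def)
  have cov: "covering (C k)" and n: "k + 2 \<le> n k" for k
    using s(1)[of k] by (simp_all add: P_def pair)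
  have less: "n k < n (Suc k)" and agr: "agree_below (n k) (C k) (C (Suc k))"
    and defeat: "agree_below (n (Suc k)) (C (Suc k)) E \<Longrightarrow> \<not> compression_function (e k) E" for k E
    using s(2)[of k] by (simp_all add: Q_def pair)
  have "mono n"
    using less by (intro mono_iff_le_Suc[THEN iffD2]) (simp add: less_imp_le)
  have agr': "agree_below (n k) (C k) (C l)" if "k \<le> l" for k l
    using that
  proof (induction l rule: dec_induct)
    case (step l)
    have "n k \<le> n l"
      using \<open>mono n\<close> step(1) by (rule monoD)
    then have "agree_below (n k) (C l) (C (Suc l))"
      using agr[of l] by (simp add: agree_below_def)
    with step.IH show ?case
      by (simp add: agree_below_def)
  qed (simp add: agree_below_def)
  \<comment> \<open>Stage \<open>length x\<close> already decides \<open>x\<close>, since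
    \<open>length x < n (length x)\<close>.\<close>
  define L where "L = {x. x \<in> C (length x)}"
  have L: "agree_below (n k) (C k) L" for k
    unfolding agree_below_def
  proof (intro allI impI)
    fix x :: str assume x: "length x < n k"
    have "length x < n (length x)"
      using n[of "length x"] by simp
    with x have "x \<in> C k \<longleftrightarrow> x \<in> C (length x)"
      using agr'[of k "length x"] agr'[of "length x" k] linear[of k "length x"]
      unfolding agree_below_def by blast
    then show "x \<in> C k \<longleftrightarrow> x \<in> L"
      by (simp add: L_def)
  qed
  have "covering L"
    unfolding covering_def
  proof (intro conjI ballI allI impI)
    show "2 \<le> length x" if "x \<in> L" for x
      using that cov by (auto simp: L_def covering_def)
    fix w :: str assume "w \<noteq> []"
    \<comment> \<open>Both extensions of \<open>w\<close> are read off the same stage, so its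
      covering property carries over.\<close>
    then show "\<exists>b. w @ [b] \<in> L"
      using cov[of "Suc (length w)"] by (auto simp: L_def covering_def)
  qed
  moreover have "\<not> compressible F L"
    unfolding compressible_def
  proof
    assume "\<exists>f\<in>F. compression_function f L"
    then obtain k where "compression_function (e k) L"
      using F by auto
    with defeat[OF L] show False
      by contradiction
  qed
  ultimately show ?thesis
    by blast
qed

theorem theorem21:
  shows "\<exists>A B :: str set. infinite A \<and> infinite B \<and> P_rankable A \<and> P_rankable B \<and>
    \<not> compressible F_PR (A \<union> B)"
proof -
  obtain C where C: "covering C" "\<not> compressible F_PR C"
    using ex_covering_incompressible[OF countable_F_PR] by blast
  obtain a b where "C = extensions a \<union> extensions b"
    using covering_eq_Un_extensions[OF C(1)] .
  with C(2) have "\<not> compressible F_PR (extensions a \<union> extensions b)"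
    by simp
  with infinite_extensions P_rankable_extensions show ?thesis
    by (intro exI conjI)
qed

end
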